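(* Let $n=p_1^{\alpha_1}p_2^{\alpha_2}\cdots p_k^{\alpha_k}$, where the $p_i$ are distinct primes, $k\geq 1$ and each $\alpha_i\geq 1$. Then $$\gamma(\mathscr{I}_c(\mathbb{Z}_n))=\begin{cases}1, & \text{if } \alpha_i>1 \text{ for some } i;\\ 2, & \text{if } \alpha_i=1 \text{ for every } i.\end{cases}$$
   Context: For a group $G$, the intersection graph of cyclic subgroups of $G$, denoted $\mathscr{I}_c(G)$, is the simple graph whose vertices are all the proper cyclic subgroups of $G$ (cyclic subgroups different from $G$ and from the trivial subgroup), two distinct vertices being adjacent if and only if their intersection is a non-trivial subgroup. $\mathbb{Z}_n$ is the cyclic group of order $n$. A dominating set of a graph is a set $D$ of vertices such that every vertex not in $D$ is adjacent to at least one member of $D$; the domination number $\gamma$ is the number of vertices in a smallest dominating set.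
   Formalization: The graph is assumed to have at least one vertex, which excludes exactly n prime (k = 1, α_1 = 1); there the graph is empty and its domination number is 0, not 2 as the formula says. *)

theory Defs
  imports
    "HOL-Algebra.Elementary_Groups"
    "HOL-Computational_Algebra.Primes"
    "Graph_Theory.Pair_Digraph"
begin

definition proper_cyclic_subgroups :: "('a, 'b) monoid_scheme \<Rightarrow> 'a set set" where
  "proper_cyclic_subgroups G =
    {H. subgroup H G \<and> cyclic_group (G\<lparr>carrier := H\<rparr>) \<and> H \<noteq> carrier G \<and> H \<noteq> {\<one>\<^bsub>G\<^esub>}}"

text \<open>A simple graph is a loop-free symmetric digraph without parallel arcs, so each edge is
  recorded by both of its orientations.\<close>

definition cyclic_intersection_graph :: "('a, 'b) monoid_scheme \<Rightarrow> 'a set pair_pre_digraph" where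
  "cyclic_intersection_graph G =
    \<lparr> pverts = proper_cyclic_subgroups G,
      parcs = {(H, K). H \<in> proper_cyclic_subgroups G \<and> K \<in> proper_cyclic_subgroups G \<and>
                       H \<noteq> K \<and> H \<inter> K \<noteq> {\<one>\<^bsub>G\<^esub>}} \<rparr>"

lemma pair_bidirected_digraph_cyclic_intersection_graph:
  "pair_bidirected_digraph (cyclic_intersection_graph G)"
  by unfold_locales
    (auto simp: cyclic_intersection_graph_def symmetric_def sym_def)

lemma pair_graph_cyclic_intersection_graph:
  assumes "finite (carrier G)"
  shows "pair_graph (cyclic_intersection_graph G)"
proof -
  interpret pair_bidirected_digraph "cyclic_intersection_graph G"
    by (rule pair_bidirected_digraph_cyclic_intersection_graph)
  have "proper_cyclic_subgroups G \<subseteq> Pow (carrier G)"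
    by (auto simp: proper_cyclic_subgroups_def dest: subgroup.subset)
  then have fin: "finite (proper_cyclic_subgroups G)"
    using assms by (meson finite_Pow_iff finite_subset)
  moreover have "parcs (cyclic_intersection_graph G) \<subseteq>
      proper_cyclic_subgroups G \<times> proper_cyclic_subgroups G"
    by (auto simp: cyclic_intersection_graph_def)
  ultimately have "finite (parcs (cyclic_intersection_graph G))"
    by (meson finite_SigmaI finite_subset)
  with fin show ?thesis
    by unfold_locales (auto simp: cyclic_intersection_graph_def)
qed

definition dominating_set :: "'a pair_pre_digraph \<Rightarrow> 'a set \<Rightarrow> bool" where
  "dominating_set \<Gamma> D \<longleftrightarrow>
    D \<subseteq> pverts \<Gamma> \<and> (\<forall>v \<in> pverts \<Gamma> - D. \<exists>u \<in> D. (v, u) \<in> parcs \<Gamma>)"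

text \<open>Only meaningful when a finite dominating set exists, as in every finite graph.\<close>

definition domination_number :: "'a pair_pre_digraph \<Rightarrow> nat" where
  "domination_number \<Gamma> = (LEAST m. \<exists>D. dominating_set \<Gamma> D \<and> finite D \<and> card D = m)"

end

theory Submission
  imports Defs "HOL-Computational_Algebra.Squarefree"
begin

text \<open>
  The subgroups of \<open>\<int>\<^sub>n\<close> are the sets of multiples of \<open>d\<close> for the divisors \<open>d\<close> of \<open>n\<close>, and intersecting
  two of them amounts to taking the least common multiple of the divisors. The intersection graph is
  therefore a graph on the divisors \<open>d\<close> of \<open>n\<close> with \<open>1 < d < n\<close>, in which distinct \<open>d\<close> and \<open>e\<close>
  are adjacent if and only if \<open>lcm d e \<noteq> n\<close>.

  Three observations on divisors settle the domination number.

  \<^item> If \<open>p\<^sup>2\<close> divides \<open>n\<close> for a prime \<open>p\<close>, then \<open>p\<close> dominates on its own: for a proper divisor \<open>e\<close>,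
    either \<open>p\<close> divides \<open>e\<close> and \<open>lcm p e = e\<close>, or \<open>lcm p e = p * e\<close> has only one factor \<open>p\<close>.

  \<^item> If \<open>n\<close> is squarefree, then a divisor \<open>d\<close> is coprime to its complement \<open>n div d\<close>, so these two are
    distinct and not adjacent. Hence no single vertex dominates.

  \<^item> A complementary pair \<open>d\<close>, \<open>n div d\<close> always dominates: if \<open>lcm e d = n\<close> then \<open>n\<close> divides \<open>e * d\<close>,
    so \<open>n div d\<close> divides \<open>e\<close> and the least common multiple of the two is \<open>e\<close> itself, which is not \<open>n\<close>.
\<close>

section \<open>The cyclic subgroups of \<open>\<int>\<^sub>n\<close>\<close>

definition multiples_mod :: "nat \<Rightarrow> nat \<Rightarrow> int set" where
  "multiples_mod n d = {x \<in> {0..<int n}. int d dvd x}"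

definition nontrivial_divisors :: "nat \<Rightarrow> nat set" where
  "nontrivial_divisors n = {d. d dvd n \<and> 1 < d \<and> d < n}"

lemma (in group) cyclic_subgroup_iff_range_int_pow:
  "subgroup H G \<and> cyclic_group (G\<lparr>carrier := H\<rparr>) \<longleftrightarrow>
   (\<exists>x \<in> carrier G. H = range (\<lambda>m::int. x [^] m))"
proof
  assume H: "subgroup H G \<and> cyclic_group (G\<lparr>carrier := H\<rparr>)"
  then interpret H: group "G\<lparr>carrier := H\<rparr>"
    using subgroup_imp_group by blast
  obtain x where "x \<in> H" "H = range (\<lambda>m::int. x [^]\<^bsub>G\<lparr>carrier := H\<rparr>\<^esub> m)"
    using H H.cyclic_group by auto
  with H have "x \<in> carrier G" "H = range (\<lambda>m::int. x [^] m)"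
    by (auto simp: int_pow_consistent [symmetric] dest: subgroup.mem_carrier)
  then show "\<exists>x \<in> carrier G. H = range (\<lambda>m::int. x [^] m)"
    by blast
next
  assume "\<exists>x \<in> carrier G. H = range (\<lambda>m::int. x [^] m)"
  then obtain x where x: "x \<in> carrier G" and H: "H = range (\<lambda>m::int. x [^] m)"
    by blast
  have sub: "subgroup H G"
    using x H subgroup_of_powers by simp
  then interpret H: group "G\<lparr>carrier := H\<rparr>"
    using subgroup_imp_group by blast
  have "x \<in> H"
    using x H by (metis int_pow_1 rangeI)
  then have "H = range (\<lambda>m::int. x [^]\<^bsub>G\<lparr>carrier := H\<rparr>\<^esub> m)"
    using H sub by (simp add: int_pow_consistent [symmetric])
  with \<open>x \<in> H\<close> show "subgroup H G \<and> cyclic_group (G\<lparr>carrier := H\<rparr>)"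
    using sub H.cyclic_group by auto
qed

text \<open>Bezout's identity: modulo \<open>n\<close>, the integers \<open>x\<close> and \<open>gcd x n\<close> are multiples of each other.\<close>

lemma range_mult_mod_eq_multiples_mod_gcd:
  assumes "n > 0"
  shows "range (\<lambda>m::int. (m * x) mod int n) = multiples_mod n (nat (gcd x (int n)))"
proof
  show "range (\<lambda>m::int. (m * x) mod int n) \<subseteq> multiples_mod n (nat (gcd x (int n)))"
    using assms by (auto simp: multiples_mod_def dvd_mod)
next
  show "multiples_mod n (nat (gcd x (int n))) \<subseteq> range (\<lambda>m::int. (m * x) mod int n)"
  proof
    fix y assume y: "y \<in> multiples_mod n (nat (gcd x (int n)))"
    then obtain c where c: "y = gcd x (int n) * c"
      by (auto simp: multiples_mod_def)
    obtain u v where uv: "u * x + v * int n = gcd x (int n)"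
      using bezout_int by blast
    have "y = (u * x + v * int n) * c"
      using c uv by simp
    then have "y = (c * u) * x + (c * v) * int n"
      by (simp add: algebra_simps)
    moreover have "y = y mod int n"
      using y by (simp add: multiples_mod_def)
    ultimately have "y = ((c * u) * x) mod int n"
      by (metis mod_mult_self1)
    then show "y \<in> range (\<lambda>m::int. (m * x) mod int n)"
      by blast
  qed
qed

text \<open>
  A divisor \<open>e < n\<close> is itself an element of its set of multiples, and \<open>n\<close> is divisible by every other
  divisor, so the inclusion order on these sets recovers divisibility.
\<close>

lemma inj_on_multiples_mod:
  assumes "n > 0"
  shows "inj_on (multiples_mod n) {d. d dvd n}"
proof (rule inj_onI)
  have dvd: "d dvd e" if "d dvd n" "e dvd n" "multiples_mod n d = multiples_mod n e" for d e
  proof (cases "e < n")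
    case True
    then have "int e \<in> multiples_mod n e"
      by (simp add: multiples_mod_def)
    with that(3) have "int e \<in> multiples_mod n d"
      by simp
    then show ?thesis
      by (simp add: multiples_mod_def)
  next
    case False
    with that(2) assms have "e = n"
      using dvd_imp_le [of e n] by simp
    with that(1) show ?thesis
      by simp
  qed
  show "d = e" if "d \<in> {d. d dvd n}" "e \<in> {d. d dvd n}" "multiples_mod n d = multiples_mod n e" for d e
    using that dvd [of d e] dvd [of e d] by (auto intro: dvd_antisym)
qed

lemma multiples_mod_eq_iff:
  "n > 0 \<Longrightarrow> d dvd n \<Longrightarrow> e dvd n \<Longrightarrow> multiples_mod n d = multiples_mod n e \<longleftrightarrow> d = e"
  using inj_on_multiples_mod [of n] by (auto dest: inj_onD)

lemma multiples_mod_1: "multiples_mod n 1 = {0..<int n}"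
  by (auto simp: multiples_mod_def)

lemma multiples_mod_self: "n > 0 \<Longrightarrow> multiples_mod n n = {0}"
  by (auto simp: multiples_mod_def zdvd_not_zless order.order_iff_strict)

lemma multiples_mod_Int:
  "multiples_mod n d \<inter> multiples_mod n e = multiples_mod n (lcm d e)"
  by (auto simp: multiples_mod_def simp flip: lcm_int_int_eq)

text \<open>
  A cyclic subgroup consists of the powers of some \<open>x\<close>, which are the multiples of \<open>gcd x n\<close>. The whole
  group and the trivial subgroup belong to the divisors \<open>1\<close> and \<open>n\<close>.
\<close>

lemma proper_cyclic_subgroups_integer_mod_group:
  assumes "n > 0"
  shows "proper_cyclic_subgroups (integer_mod_group n) = multiples_mod n ` nontrivial_divisors n"
proof -
  have cyc: "subgroup H (integer_mod_group n) \<and> cyclic_group (integer_mod_group n\<lparr>carrier := H\<rparr>)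
      \<longleftrightarrow> (\<exists>d. d dvd n \<and> H = multiples_mod n d)" for H
  proof -
    have "subgroup H (integer_mod_group n) \<and> cyclic_group (integer_mod_group n\<lparr>carrier := H\<rparr>)
      \<longleftrightarrow> (\<exists>x \<in> {0..<int n}. H = multiples_mod n (nat (gcd x (int n))))"
      using assms group.cyclic_subgroup_iff_range_int_pow [OF group_integer_mod_group, of H n]
      by (simp add: int_pow_integer_mod_group range_mult_mod_eq_multiples_mod_gcd
          carrier_integer_mod_group)
    also have "\<dots> \<longleftrightarrow> (\<exists>d. d dvd n \<and> H = multiples_mod n d)"
    proof
      assume "\<exists>x \<in> {0..<int n}. H = multiples_mod n (nat (gcd x (int n)))"
      moreover have "nat (gcd x (int n)) dvd n" for x
        by (metis gcd_dvd2 gcd_ge_0_int int_dvd_int_iff int_nat_eq)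
      ultimately show "\<exists>d. d dvd n \<and> H = multiples_mod n d"
        by blast
    next
      assume "\<exists>d. d dvd n \<and> H = multiples_mod n d"
      then obtain d where d: "d dvd n" "H = multiples_mod n d"
        by blast
      \<comment> \<open>The subgroup is generated by the residue of \<open>d\<close>, which is \<open>0\<close> when \<open>d = n\<close>.\<close>
      have "nat (gcd (int d mod int n) (int n)) = d"
        using d(1) by (metis gcd.commute gcd_int_int_eq gcd_nat.absorb_iff1 gcd_red_int nat_int)
      moreover have "int d mod int n \<in> {0..<int n}"
        using assms by simp
      ultimately show "\<exists>x \<in> {0..<int n}. H = multiples_mod n (nat (gcd x (int n)))"
        using d(2) by metis
    qed
    finally show ?thesis .
  qed
  have divisor: "d \<in> nontrivial_divisors n \<longleftrightarrow> d dvd n \<and> d \<noteq> 1 \<and> d \<noteq> n" for d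
    using assms dvd_imp_le [of d n] dvd_pos_nat [of n d] by (auto simp: nontrivial_divisors_def)
  have "H \<in> proper_cyclic_subgroups (integer_mod_group n) \<longleftrightarrow>
      H \<in> multiples_mod n ` nontrivial_divisors n" for H
  proof -
    have "H \<in> proper_cyclic_subgroups (integer_mod_group n) \<longleftrightarrow>
      (\<exists>d. d dvd n \<and> H = multiples_mod n d \<and> H \<noteq> multiples_mod n 1 \<and> H \<noteq> multiples_mod n n)"
      using assms cyc [of H] unfolding proper_cyclic_subgroups_def multiples_mod_1
      by (auto simp: multiples_mod_self carrier_integer_mod_group)
    also have "\<dots> \<longleftrightarrow> (\<exists>d. d dvd n \<and> H = multiples_mod n d \<and> d \<noteq> 1 \<and> d \<noteq> n)"
      using assms by (metis dvd_refl multiples_mod_eq_iff one_dvd)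
    also have "\<dots> \<longleftrightarrow> H \<in> multiples_mod n ` nontrivial_divisors n"
      unfolding image_iff Bex_def divisor by blast
    finally show ?thesis .
  qed
  then show ?thesis
    by blast
qed

section \<open>The intersection graph as a graph on divisors\<close>

lemma pverts_cyclic_intersection_graph_integer_mod_group:
  "n > 0 \<Longrightarrow> pverts (cyclic_intersection_graph (integer_mod_group n)) =
    multiples_mod n ` nontrivial_divisors n"
  by (simp add: cyclic_intersection_graph_def proper_cyclic_subgroups_integer_mod_group)

text \<open>The intersection is the subgroup of multiples of the least common multiple, and the subgroup of a
  divisor is trivial only when that divisor is \<open>n\<close>.\<close>

lemma parcs_cyclic_intersection_graph_integer_mod_group_iff:
  assumes "n > 0" "d \<in> nontrivial_divisors n" "e \<in> nontrivial_divisors n"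
  shows "(multiples_mod n d, multiples_mod n e) \<in> parcs (cyclic_intersection_graph (integer_mod_group n))
    \<longleftrightarrow> d \<noteq> e \<and> lcm d e \<noteq> n"
proof -
  have "d dvd n" "e dvd n"
    using assms by (auto simp: nontrivial_divisors_def)
  then have "multiples_mod n d = multiples_mod n e \<longleftrightarrow> d = e"
      "multiples_mod n (lcm d e) = {0} \<longleftrightarrow> lcm d e = n"
    using assms(1) multiples_mod_eq_iff [of n d e] multiples_mod_eq_iff [of n "lcm d e" n]
    by (simp_all add: multiples_mod_self)
  then show ?thesis
    using assms by (simp add: cyclic_intersection_graph_def proper_cyclic_subgroups_integer_mod_group
        multiples_mod_Int)
qed

definition dominating_divisors :: "nat \<Rightarrow> nat set \<Rightarrow> bool" where
  "dominating_divisors n A \<longleftrightarrow>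
    A \<subseteq> nontrivial_divisors n \<and> (\<forall>e \<in> nontrivial_divisors n - A. \<exists>d \<in> A. lcm e d \<noteq> n)"

text \<open>Since divisors correspond injectively to subgroups, passing to divisors preserves the size of
  dominating sets.\<close>

lemma domination_number_integer_mod_group:
  assumes "n > 0"
  shows "domination_number (cyclic_intersection_graph (integer_mod_group n)) =
    (LEAST m. \<exists>A. dominating_divisors n A \<and> finite A \<and> card A = m)"
proof -
  let ?\<Gamma> = "cyclic_intersection_graph (integer_mod_group n)"
  have inj: "inj_on (multiples_mod n) (nontrivial_divisors n)"
    by (rule inj_on_subset [OF inj_on_multiples_mod [OF assms]]) (auto simp: nontrivial_divisors_def)
  have dom: "dominating_set ?\<Gamma> (multiples_mod n ` A) \<longleftrightarrow> dominating_divisors n A"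
    if A: "A \<subseteq> nontrivial_divisors n" for A
  proof -
    have "dominating_set ?\<Gamma> (multiples_mod n ` A) \<longleftrightarrow>
        (\<forall>e \<in> nontrivial_divisors n - A. \<exists>d \<in> A.
          (multiples_mod n e, multiples_mod n d) \<in> parcs ?\<Gamma>)"
      using A assms inj
      by (simp add: dominating_set_def pverts_cyclic_intersection_graph_integer_mod_group
          image_mono inj_on_image_set_diff [OF inj, symmetric])
    also have "\<dots> \<longleftrightarrow> (\<forall>e \<in> nontrivial_divisors n - A. \<exists>d \<in> A. lcm e d \<noteq> n)"
      using A assms
      by (intro ball_cong bex_cong refl)
        (auto simp: parcs_cyclic_intersection_graph_integer_mod_group_iff subset_iff)
    finally show ?thesis
      using A by (simp add: dominating_divisors_def)
  qed
  have "(\<exists>D. dominating_set ?\<Gamma> D \<and> finite D \<and> card D = m) \<longleftrightarrow>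
      (\<exists>A. dominating_divisors n A \<and> finite A \<and> card A = m)" for m
  proof
    assume "\<exists>D. dominating_set ?\<Gamma> D \<and> finite D \<and> card D = m"
    then obtain D where D: "dominating_set ?\<Gamma> D" "finite D" "card D = m"
      by blast
    then have "D \<subseteq> multiples_mod n ` nontrivial_divisors n"
      using assms by (simp add: dominating_set_def pverts_cyclic_intersection_graph_integer_mod_group)
    then obtain A where A: "A \<subseteq> nontrivial_divisors n" "D = multiples_mod n ` A"
      by (rule subset_imageE)
    then have "inj_on (multiples_mod n) A"
      using inj inj_on_subset by blast
    then show "\<exists>A. dominating_divisors n A \<and> finite A \<and> card A = m"
      using A D dom by (metis card_image finite_image_iff)
  next
    assume "\<exists>A. dominating_divisors n A \<and> finite A \<and> card A = m"
    then obtain A where A: "dominating_divisors n A" "finite A" "card A = m"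
      by blast
    then have sub: "A \<subseteq> nontrivial_divisors n"
      by (simp add: dominating_divisors_def)
    then have "card (multiples_mod n ` A) = m"
      using A inj by (metis card_image inj_on_subset)
    then show "\<exists>D. dominating_set ?\<Gamma> D \<and> finite D \<and> card D = m"
      using A sub dom by blast
  qed
  then show ?thesis
    by (simp add: domination_number_def)
qed

section \<open>Domination among divisors\<close>

text \<open>
  The prime \<open>p\<close> meets every vertex: if \<open>p\<close> does not divide \<open>e\<close>, then \<open>p\<^sup>2\<close> does not divide \<open>e * p\<close>,
  so \<open>lcm e p\<close> cannot be \<open>n\<close>. The hypothesis \<open>p\<^sup>2 dvd n\<close> also gives \<open>p < n\<close>, which makes \<open>p\<close> a vertex.
\<close>

lemma domination_number_integer_mod_group_not_squarefree:
  assumes "n > 0" "prime p" "p\<^sup>2 dvd n"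
  shows "domination_number (cyclic_intersection_graph (integer_mod_group n)) = 1"
proof -
  have pn: "p dvd n"
    using assms(3) by (metis dvd_mult_left power2_eq_square)
  have "p < p\<^sup>2"
    using prime_gt_1_nat [OF assms(2)] by (simp add: power2_eq_square)
  then have p: "p \<in> nontrivial_divisors n"
    using assms pn prime_gt_1_nat [OF assms(2)] dvd_imp_le [OF assms(3)]
    by (simp add: nontrivial_divisors_def)
  have "lcm e p \<noteq> n" if e: "e \<in> nontrivial_divisors n" for e
  proof (cases "p dvd e")
    case True
    with e show ?thesis
      by (simp add: nontrivial_divisors_def)
  next
    case False
    show ?thesis
    proof
      assume "lcm e p = n"
      then have "n dvd e * p"
        using lcm_least [of e "e * p" p] by simp
      then have "p * p dvd e * p"
        using assms(3) by (metis dvd_trans power2_eq_square)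
      then show False
        using False prime_gt_0_nat [OF assms(2)] by simp
    qed
  qed
  with p have dom: "dominating_divisors n {p}"
    by (simp add: dominating_divisors_def)
  show ?thesis
    unfolding domination_number_integer_mod_group [OF assms(1)]
  proof (rule Least_equality)
    show "\<exists>A. dominating_divisors n A \<and> finite A \<and> card A = 1"
      using dom by (intro exI [of _ "{p}"]) simp
  next
    fix m assume "\<exists>A. dominating_divisors n A \<and> finite A \<and> card A = m"
    then show "1 \<le> m"
      using p by (auto simp: dominating_divisors_def Suc_le_eq card_gt_0_iff)
  qed
qed

lemma squarefree_mult_imp_coprime:
  fixes a b :: "'a :: semiring_gcd"
  assumes "squarefree (a * b)"
  shows "coprime a b"
proof (rule coprimeI)
  fix c assume "c dvd a" "c dvd b"
  then have "c\<^sup>2 dvd a * b"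
    by (simp add: power2_eq_square mult_dvd_mono)
  with assms show "is_unit c"
    by (rule squarefreeD)
qed

text \<open>
  A divisor \<open>e \<noteq> d\<close> not adjacent to \<open>d\<close> satisfies \<open>n dvd e * d\<close>, so it is a multiple of \<open>n div d\<close>: the
  subgroup of \<open>e\<close> lies inside that of \<open>n div d\<close>.
\<close>

lemma dominating_divisors_complementary:
  assumes "n > 0" "d \<in> nontrivial_divisors n"
  shows "dominating_divisors n {d, n div d}"
proof -
  obtain c where c: "n = d * c"
    using assms by (auto simp: nontrivial_divisors_def)
  with assms have gt: "1 < d" "1 < c" "n div d = c"
    by (auto simp: nontrivial_divisors_def)
  have cn: "c \<in> nontrivial_divisors n"
    using c gt by (simp add: nontrivial_divisors_def)
  have "lcm e c \<noteq> n" if e: "e \<in> nontrivial_divisors n" and "lcm e d = n" for e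
  proof -
    have "d * c dvd e * d"
      using \<open>lcm e d = n\<close> c lcm_least [of e "e * d" d] by simp
    then have "c dvd e"
      using gt by (simp add: mult.commute)
    with e show ?thesis
      by (simp add: nontrivial_divisors_def)
  qed
  with assms(2) cn gt(3) show ?thesis
    by (auto simp: dominating_divisors_def)
qed

text \<open>Squarefreeness makes \<open>d\<close> and \<open>n div d\<close> coprime, so the complement of \<open>d\<close> is a vertex that
  \<open>d\<close> fails to dominate; together, by the previous lemma, the two dominate.\<close>

lemma domination_number_integer_mod_group_squarefree:
  assumes "squarefree n" "nontrivial_divisors n \<noteq> {}"
  shows "domination_number (cyclic_intersection_graph (integer_mod_group n)) = 2"
proof -
  have "n > 0"
    using assms(1) by (cases "n = 0") auto
  have compl: "n div d \<in> nontrivial_divisors n \<and> n div d \<noteq> d \<and> lcm (n div d) d = n"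
    if d: "d \<in> nontrivial_divisors n" for d
  proof -
    obtain c where c: "n = d * c"
      using d by (auto simp: nontrivial_divisors_def)
    with d have gt: "1 < d" "1 < c" "n div d = c"
      by (auto simp: nontrivial_divisors_def)
    have "coprime c d"
      using assms(1) c squarefree_mult_imp_coprime by (metis coprime_commute)
    then show ?thesis
      using c gt by (auto simp: nontrivial_divisors_def lcm_coprime)
  qed
  obtain d where d: "d \<in> nontrivial_divisors n"
    using assms(2) by blast
  show ?thesis
    unfolding domination_number_integer_mod_group [OF \<open>n > 0\<close>]
  proof (rule Least_equality)
    show "\<exists>A. dominating_divisors n A \<and> finite A \<and> card A = 2"
      using dominating_divisors_complementary [OF \<open>n > 0\<close> d] compl [OF d]
      by (intro exI [of _ "{d, n div d}"]) auto
  next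
    fix m assume "\<exists>A. dominating_divisors n A \<and> finite A \<and> card A = m"
    then obtain A where A: "dominating_divisors n A" "finite A" "card A = m"
      by blast
    have "A \<noteq> {}"
      using A(1) d by (auto simp: dominating_divisors_def)
    then have "m \<noteq> 0"
      using A(2,3) by auto
    moreover have "m \<noteq> 1"
    proof
      assume "m = 1"
      then obtain a where "A = {a}"
        using A(3) card_1_singletonE by blast
      with A(1) compl [of a] show False
        by (auto simp: dominating_divisors_def)
    qed
    ultimately show "2 \<le> m"
      by linarith
  qed
qed

theorem theorem2p12:
  fixes n k :: nat and p \<alpha> :: "nat \<Rightarrow> nat"
  assumes "k \<ge> 1"
    and "\<And>i. i \<in> {1..k} \<Longrightarrow> prime (p i)"
    and "inj_on p {1..k}"
    and "\<And>i. i \<in> {1..k} \<Longrightarrow> \<alpha> i \<ge> 1"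
    and "n = (\<Prod>i = 1..k. p i ^ \<alpha> i)"
    and "pverts (cyclic_intersection_graph (integer_mod_group n)) \<noteq> {}"
  shows "((\<exists>i \<in> {1..k}. \<alpha> i > 1) \<longrightarrow>
            domination_number (cyclic_intersection_graph (integer_mod_group n)) = 1) \<and>
         ((\<forall>i \<in> {1..k}. \<alpha> i = 1) \<longrightarrow>
            domination_number (cyclic_intersection_graph (integer_mod_group n)) = 2)"
proof -
  have n: "n > 0"
    using assms(2,5) by (auto intro!: prod_pos simp: prime_gt_0_nat)
  show ?thesis
  proof (intro conjI impI)
    assume "\<exists>i \<in> {1..k}. \<alpha> i > 1"
    then obtain i where i: "i \<in> {1..k}" "\<alpha> i > 1"
      by blast
    then have "(p i)\<^sup>2 dvd p i ^ \<alpha> i"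
      by (intro le_imp_power_dvd) simp
    also have "\<dots> dvd n"
      unfolding assms(5) using i(1) by (intro dvd_prodI) auto
    finally show "domination_number (cyclic_intersection_graph (integer_mod_group n)) = 1"
      using n assms(2) i(1) domination_number_integer_mod_group_not_squarefree by blast
  next
    assume "\<forall>i \<in> {1..k}. \<alpha> i = 1"
    then have "n = (\<Prod>i = 1..k. p i)"
      using assms(5) by simp
    moreover have "squarefree (\<Prod>i = 1..k. p i)"
      using assms(2,3)
      by (intro squarefree_prod_coprime squarefree_prime primes_coprime) (auto dest: inj_onD)
    ultimately have "squarefree n"
      by simp
    moreover have "nontrivial_divisors n \<noteq> {}"
      using assms(6) n by (simp add: pverts_cyclic_intersection_graph_integer_mod_group)
    ultimately show "domination_number (cyclic_intersection_graph (integer_mod_group n)) = 2"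
      by (rule domination_number_integer_mod_group_squarefree)
  qed
qed

end
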